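(* Let $A\in\mathcal{M}_{m\times n}$, $B\in\mathcal{M}_{m\times p}$, $C\in\mathcal{M}_{q\times m}$ and consider the discrete-time control system $$x(t+1)=A\,\vec{\ltimes}\,x(t)\;\vec{+}\;Bu(t),\qquad y(t)=C\,\vec{\ltimes}\,x(t),\qquad x(t)\in\mathcal{V},\ u(t)\in\mathbb{R}^p .$$ (1) The system is controllable from $\mathcal{V}_i$ to $\mathcal{V}_j$ if the following three conditions hold: (i) $A$ is dimension-bounded; (ii) with $r_0:=\dim\mathcal{V}_i=i$ and $r_*:=\dim\mathcal{V}_j=j$, the dimension sequence started at $r_0$ terminates at $r_*$ (i.e. $r_l=r_*$ for all sufficiently large $l$); (iii) the stationary realization on $\mathcal{V}_{r_*}$ is controllable (as a standard linear control system). (2) If (i) and (ii) hold, then (iii) is also necessary for the system to be controllable from $\mathcal{V}_i$ to $\mathcal{V}_j$.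
   Context: $\mathbb{N}=\{1,2,\dots\}$; $\mathcal{M}_{m\times n}$: real $m\times n$ matrices; $\mathcal{V}=\bigcup_{n\ge1}\mathcal{V}_n$ (disjoint union), $\mathcal{V}_n=\mathbb{R}^n$ (column vectors); $\mathbf{1}_k\in\mathbb{R}^k$ is the all-ones column; $\otimes$ the Kronecker product; $a\vee b$ the least common multiple. V-product: for $A\in\mathcal{M}_{m\times n}$, $x\in\mathcal{V}_r$, $t=n\vee r$: $A\,\vec{\ltimes}\,x:=(A\otimes I_{t/n})(x\otimes\mathbf{1}_{t/r})$. V-addition (written $\vec{+}$ here): for $x\in\mathcal{V}_a$, $y\in\mathcal{V}_b$, $t=a\vee b$: $x\,\vec{+}\,y:=(x\otimes\mathbf{1}_{t/a})+(y\otimes\mathbf{1}_{t/b})\in\mathcal{V}_t$. Dimension-bounded: $A$ is dimension-bounded if for every $r$ and every $x_0\in\mathcal{V}_r$ there exist $N\ge0$ and $r_*$ such that the trajectory of $x(t+1)=A\,\vec{\ltimes}\,x(t)$, $x(0)=x_0$, satisfies $x(t)\in\mathcal{V}_{r_*}$ for all $t\ge N$. It is known that $A\in\mathcal{M}_{m\times n}$ is dimension-bounded if and only if $m\mid n$; then write $n=m\mu_x$. Dimension sequence (for $A\in\mathcal{M}_{m\times m\mu_x}$) started at $r_0$: $\xi_0:=\frac{r_0\vee(m\mu_x)}{m\mu_x}$, and for $l\ge1$, $r_l:=\xi_{l-1}m$, $\xi_l:=\frac{\xi_{l-1}\vee\mu_x}{\mu_x}$. The sequence is eventually constant; its eventual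 value $r_*$ is a multiple of $m$ and $A\,\vec{\ltimes}\,x\in\mathcal{V}_{r_*}$ for all $x\in\mathcal{V}_{r_*}$. Stationary realization on $\mathcal{V}_{r_*}$: the standard linear control system on $\mathbb{R}^{r_*}$ $x(t+1)=A_sx(t)+B_su(t)$, $y(t)=C_sx(t)$, where $A_s$ is the $r_*\times r_*$ matrix with $A_sx=A\,\vec{\ltimes}\,x$ for all $x\in\mathcal{V}_{r_*}$, $B_s=B\otimes\mathbf{1}_{r_*/m}$, $C_s=C\otimes I_{r_*/m}$. Controllability: the system is controllable from $x_0\in\mathcal{V}$ to $x_d\in\mathcal{V}$ if there exist $T>0$ and inputs $u_0,u_1,\dots,u_{T-1}$ driving the trajectory from $x(0)=x_0$ to $x(T)=x_d$; it is controllable from $\mathcal{V}_i$ to $\mathcal{V}_j$ if it is controllable from any $x_0\in\mathcal{V}_i$ to any $x_d\in\mathcal{V}_j$. *)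

theory Defs
  imports "Jordan_Normal_Form.Matrix"
begin

text \<open>
  The disjoint union of the spaces \<open>\<real>\<^sup>n\<close>, \<open>n \<ge> 1\<close>, is rendered by the type \<^typ>\<open>real vec\<close>, whose
  elements carry their dimension; the component of index \<open>n\<close> is \<^term>\<open>carrier_vec n\<close>. The type
  also contains the empty vector, which is excluded below by positivity of the dimension.
\<close>

definition kron :: "real mat \<Rightarrow> real mat \<Rightarrow> real mat" where
  "kron A B = mat (dim_row A * dim_row B) (dim_col A * dim_col B)
     (\<lambda>(i, j). A $$ (i div dim_row B, j div dim_col B) * B $$ (i mod dim_row B, j mod dim_col B))"

definition kron_vec :: "real vec \<Rightarrow> real vec \<Rightarrow> real vec" where
  "kron_vec x y = vec (dim_vec x * dim_vec y) (\<lambda>i. x $ (i div dim_vec y) * y $ (i mod dim_vec y))"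

abbreviation col_mat :: "real vec \<Rightarrow> real mat" where
  "col_mat x \<equiv> mat_of_cols (dim_vec x) [x]"

lemma col_mat_kron_vec: "col_mat (kron_vec x y) = kron (col_mat x) (col_mat y)"
proof (rule eq_matI)
  fix i j
  assume i: "i < dim_row (kron (col_mat x) (col_mat y))"
    and j: "j < dim_col (kron (col_mat x) (col_mat y))"
  have i': "i < dim_vec x * dim_vec y" and j': "j = 0"
    using i j by (auto simp: kron_def)
  have "dim_vec y > 0" using i' by (cases "dim_vec y") auto
  then have "i div dim_vec y < dim_vec x" "i mod dim_vec y < dim_vec y"
    using i' by (auto simp: less_mult_imp_div_less)
  then show "col_mat (kron_vec x y) $$ (i, j) = kron (col_mat x) (col_mat y) $$ (i, j)"
    using i' j' by (simp add: kron_def kron_vec_def mat_of_cols_def)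
qed (auto simp: kron_def kron_vec_def)

definition ones :: "nat \<Rightarrow> real vec" where
  "ones k = vec k (\<lambda>_. 1)"

definition vprod :: "real mat \<Rightarrow> real vec \<Rightarrow> real vec" where
  "vprod A x = (let t = lcm (dim_col A) (dim_vec x) in
     kron A (1\<^sub>m (t div dim_col A)) *\<^sub>v kron_vec x (ones (t div dim_vec x)))"

definition vadd :: "real vec \<Rightarrow> real vec \<Rightarrow> real vec" where
  "vadd x y = (let t = lcm (dim_vec x) (dim_vec y) in
     kron_vec x (ones (t div dim_vec x)) + kron_vec y (ones (t div dim_vec y)))"

definition dimension_bounded :: "real mat \<Rightarrow> bool" where
  "dimension_bounded A \<longleftrightarrow>
     (\<forall>r\<ge>1. \<forall>x0\<in>carrier_vec r. \<exists>N. \<exists>rs\<ge>1. \<forall>t\<ge>N. (vprod A ^^ t) x0 \<in> carrier_vec rs)"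

text \<open>
  The dimension sequence of an \<open>m \<times> m\<mu>\<close> matrix started at \<open>r0\<close>.
\<close>

fun dim_xi :: "nat \<Rightarrow> nat \<Rightarrow> nat \<Rightarrow> nat \<Rightarrow> nat" where
  "dim_xi m \<mu> r0 0 = lcm r0 (m * \<mu>) div (m * \<mu>)"
| "dim_xi m \<mu> r0 (Suc l) = lcm (dim_xi m \<mu> r0 l) \<mu> div \<mu>"

fun dim_seq :: "nat \<Rightarrow> nat \<Rightarrow> nat \<Rightarrow> nat \<Rightarrow> nat" where
  "dim_seq m \<mu> r0 0 = r0"
| "dim_seq m \<mu> r0 (Suc l) = dim_xi m \<mu> r0 l * m"

text \<open>
  The quotient below is \<open>\<mu>\<close> when \<open>m\<close> divides \<open>n\<close>, that is, when \<open>A\<close> is dimension-bounded; otherwise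
  the dimension sequence is not defined and the value of this predicate is meaningless.
\<close>

definition dim_seq_terminates_at :: "real mat \<Rightarrow> nat \<Rightarrow> nat \<Rightarrow> bool" where
  "dim_seq_terminates_at A r0 rs \<longleftrightarrow>
     (\<exists>L. \<forall>l\<ge>L. dim_seq (dim_row A) (dim_col A div dim_row A) r0 l = rs)"

text \<open>
  The same coefficient data are read either as a dimension-varying system
  (with \<^const>\<open>vprod\<close> and \<^const>\<open>vadd\<close>) or, for square \<open>stA\<close>, as an ordinary linear system.
\<close>

record control_system =
  stA :: "real mat"
  stB :: "real mat"
  stC :: "real mat"

definition v_trajectory ::
    "control_system \<Rightarrow> nat \<Rightarrow> (nat \<Rightarrow> real vec) \<Rightarrow> (nat \<Rightarrow> real vec) \<Rightarrow> (nat \<Rightarrow> real vec) \<Rightarrow> bool" where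
  "v_trajectory S T u x y \<longleftrightarrow>
     (\<forall>t<T. u t \<in> carrier_vec (dim_col (stB S)) \<and>
            x (Suc t) = vadd (vprod (stA S) (x t)) (stB S *\<^sub>v u t)) \<and>
     (\<forall>t\<le>T. y t = vprod (stC S) (x t))"

definition lin_trajectory ::
    "control_system \<Rightarrow> nat \<Rightarrow> (nat \<Rightarrow> real vec) \<Rightarrow> (nat \<Rightarrow> real vec) \<Rightarrow> (nat \<Rightarrow> real vec) \<Rightarrow> bool" where
  "lin_trajectory S T u x y \<longleftrightarrow>
     (\<forall>t<T. u t \<in> carrier_vec (dim_col (stB S)) \<and>
            x (Suc t) = stA S *\<^sub>v x t + stB S *\<^sub>v u t) \<and>
     (\<forall>t\<le>T. y t = stC S *\<^sub>v x t)"

definition v_controllable_from_to :: "control_system \<Rightarrow> real vec \<Rightarrow> real vec \<Rightarrow> bool" where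
  "v_controllable_from_to S x0 xd \<longleftrightarrow>
     (\<exists>T>0. \<exists>u x y. v_trajectory S T u x y \<and> x 0 = x0 \<and> x T = xd)"

definition v_controllable :: "control_system \<Rightarrow> nat \<Rightarrow> nat \<Rightarrow> bool" where
  "v_controllable S i j \<longleftrightarrow>
     (\<forall>x0\<in>carrier_vec i. \<forall>xd\<in>carrier_vec j. v_controllable_from_to S x0 xd)"

definition lin_controllable_from_to :: "control_system \<Rightarrow> real vec \<Rightarrow> real vec \<Rightarrow> bool" where
  "lin_controllable_from_to S x0 xd \<longleftrightarrow>
     (\<exists>T>0. \<exists>u x y. lin_trajectory S T u x y \<and> x 0 = x0 \<and> x T = xd)"

definition lin_controllable :: "control_system \<Rightarrow> bool" where
  "lin_controllable S \<longleftrightarrow>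
     (\<forall>x0\<in>carrier_vec (dim_row (stA S)). \<forall>xd\<in>carrier_vec (dim_row (stA S)).
        lin_controllable_from_to S x0 xd)"

definition stationary_matrix :: "real mat \<Rightarrow> nat \<Rightarrow> real mat" where
  "stationary_matrix A r =
     (THE As. As \<in> carrier_mat r r \<and> (\<forall>x\<in>carrier_vec r. As *\<^sub>v x = vprod A x))"

definition stationary_realization :: "control_system \<Rightarrow> nat \<Rightarrow> control_system" where
  "stationary_realization S r =
     (let m = dim_row (stA S) in
      \<lparr>stA = stationary_matrix (stA S) r,
       stB = kron (stB S) (col_mat (ones (r div m))),
       stC = kron (stC S) (1\<^sub>m (r div m))\<rparr>)"

text \<open>
  The definite description in \<^const>\<open>stationary_matrix\<close> is proper whenever \<^term>\<open>vprod A\<close>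
  maps \<^term>\<open>carrier_vec r\<close> into itself.
\<close>

lemma stationary_matrix_ex1:
  assumes r: "r > 0" and n: "dim_col A > 0"
    and inv: "\<And>x. x \<in> carrier_vec r \<Longrightarrow> vprod A x \<in> carrier_vec r"
  shows "\<exists>!As. As \<in> carrier_mat r r \<and> (\<forall>x\<in>carrier_vec r. As *\<^sub>v x = vprod A x)"
proof (rule ex_ex1I)
  define t where "t = lcm (dim_col A) r"
  define k where "k = t div r"
  define K where "K = kron A (1\<^sub>m (t div dim_col A))"
  define E where "E = mat t r (\<lambda>(a, b). if a div k = b then 1 else (0::real))"
  have rk: "r * k = t" by (simp add: k_def t_def)
  have "t > 0" using r n by (simp add: t_def lcm_pos_nat)
  then have k0: "k > 0" using rk by (cases k) auto
  have K: "K \<in> carrier_mat (dim_row K) t" by (auto simp: K_def kron_def t_def)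
  have E: "E \<in> carrier_mat t r" by (simp add: E_def)
  have Ex: "E *\<^sub>v x = kron_vec x (ones k)" if x: "x \<in> carrier_vec r" for x
  proof (rule eq_vecI)
    fix a assume "a < dim_vec (kron_vec x (ones k))"
    then have a: "a < t" using x rk by (simp add: kron_vec_def ones_def)
    then have ak: "a div k < r" using rk by (simp add: less_mult_imp_div_less)
    have "(E *\<^sub>v x) $ a = (\<Sum>b = 0..<r. (if a div k = b then 1 else 0) * x $ b)"
      using a x by (auto simp: E_def scalar_prod_def intro!: sum.cong)
    also have "\<dots> = (\<Sum>b = 0..<r. if a div k = b then x $ b else 0)"
      by (intro sum.cong) auto
    also have "\<dots> = x $ (a div k)" using ak by simp
    finally show "(E *\<^sub>v x) $ a = kron_vec x (ones k) $ a"
      using a x rk k0 by (simp add: kron_vec_def ones_def)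
  qed (use x rk in \<open>simp add: kron_vec_def ones_def E_def\<close>)
  have KE: "(K * E) *\<^sub>v x = vprod A x" if x: "x \<in> carrier_vec r" for x
    using assoc_mult_mat_vec[OF K E x] Ex[OF x] x
    by (simp add: vprod_def Let_def K_def k_def t_def)
  have "dim_row K = r"
    using carrier_vecD[OF inv[OF zero_carrier_vec]]
    unfolding vprod_def Let_def K_def t_def dim_mult_mat_vec index_zero_vec .
  then have "K * E \<in> carrier_mat r r" using mult_carrier_mat[OF K E] by metis
  then show "\<exists>As. As \<in> carrier_mat r r \<and> (\<forall>x\<in>carrier_vec r. As *\<^sub>v x = vprod A x)"
    using KE by blast
next
  fix P Q
  assume P: "P \<in> carrier_mat r r \<and> (\<forall>x\<in>carrier_vec r. P *\<^sub>v x = vprod A x)"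
    and Q: "Q \<in> carrier_mat r r \<and> (\<forall>x\<in>carrier_vec r. Q *\<^sub>v x = vprod A x)"
  then have PQ: "P *\<^sub>v unit_vec r b = Q *\<^sub>v unit_vec r b" for b by simp
  have dP: "dim_row P = r" "dim_col P = r" and dQ: "dim_row Q = r" "dim_col Q = r"
    using P Q by auto
  show "P = Q"
  proof (rule eq_matI)
    fix a b assume "a < dim_row Q" "b < dim_col Q"
    then show "P $$ (a, b) = Q $$ (a, b)"
      using arg_cong[OF PQ[of b], of "\<lambda>v. v $ a"] by (simp add: dP dQ)
  qed (simp_all add: dP dQ)
qed

end

theory Submission
  imports Defs
begin

text \<open>
  The dimension of \<open>A x + B u\<close> depends on the dimension of \<open>x\<close> alone, so along every trajectory
  starting in dimension \<open>i\<close> the dimensions follow the dimension sequence, whatever the input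
  (\<open>dim_v_step\<close>, \<open>dim_seq_Suc\<close>). On vectors of the stationary dimension \<open>j\<close> the
  dimension-varying system coincides with its stationary realization (\<open>v_state_eq_lin_state\<close>).

  Sufficiency is then immediate: apply zero inputs until the state has dimension \<open>j\<close>, and steer the
  resulting state to the target by the linear system.

  For necessity, only the start at the zero vector of dimension \<open>i\<close> is used. The target may be
  reached at a time that depends on it, and states passed on the way need not have dimension \<open>j\<close>, so
  a trajectory cannot simply be cut at a moment after which everything is linear. Instead, call two
  vectors equivalent if some repetitions \<open>x \<otimes> 1\<^sub>k\<close> and \<open>y \<otimes> 1\<^sub>l\<close> of their entries are equal, that
  is, if they are the same step function on the unit interval. The product by \<open>A\<close> and the addition
  of \<open>B u\<close> respect this equivalence (\<open>stretch_equiv_vprod\<close>, \<open>stretch_equiv_vadd\<close>), and the zero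
  vectors of dimensions \<open>i\<close> and \<open>j\<close> are equivalent. Hence the same inputs applied to the zero
  vector of dimension \<open>j\<close> lead to an equivalent vector, which is equal to the target because it has
  the same dimension. So the linear system reaches every vector from zero. The vectors reachable
  from zero in time \<open>T\<close> form an increasing chain of subspaces, and finitely many unit vectors span
  the space, so a single time serves for all targets (\<open>reachable_uniform\<close>); by superposition it
  serves for all initial states as well (\<open>lin_controllable_if_reachable\<close>).
\<close>

section \<open>Repeating the entries of a vector\<close>

abbreviation stretch :: "real vec \<Rightarrow> nat \<Rightarrow> real vec" where
  "stretch x k \<equiv> kron_vec x (ones k)"

lemma dim_stretch [simp]: "dim_vec (stretch x k) = dim_vec x * k"
  by (simp add: kron_vec_def ones_def)

lemma index_stretch [simp]:
  assumes "a < dim_vec x * k"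
  shows "stretch x k $ a = x $ (a div k)"
proof -
  have "k > 0" using assms by (cases k) auto
  then show ?thesis using assms by (simp add: kron_vec_def ones_def)
qed

lemma stretch_1 [simp]: "stretch x (Suc 0) = x"
  by (rule eq_vecI) auto

lemma stretch_stretch: "stretch (stretch x k) l = stretch x (k * l)"
proof (rule eq_vecI)
  fix a assume "a < dim_vec (stretch x (k * l))"
  then have "a < dim_vec x * (k * l)" by simp
  moreover from this have "a div l < dim_vec x * k"
    by (simp add: less_mult_imp_div_less mult.assoc)
  ultimately show "stretch (stretch x k) l $ a = stretch x (k * l) $ a"
    by (simp add: div_mult2_eq mult.assoc mult.commute[of k l])
qed (simp add: mult.assoc)

lemma stretch_cancel:
  assumes "k > 0" "dim_vec x = dim_vec y" "stretch x k = stretch y k"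
  shows "x = y"
proof (rule eq_vecI)
  fix a assume a: "a < dim_vec y"
  have ak: "a * k < dim_vec y * k" using a assms(1) by simp
  have "stretch x k $ (a * k) = stretch y k $ (a * k)" using assms(3) by simp
  moreover have "stretch x k $ (a * k) = x $ a" using ak assms(1,2) by (subst index_stretch) auto
  moreover have "stretch y k $ (a * k) = y $ a" using ak assms(1) by (subst index_stretch) auto
  ultimately show "x $ a = y $ a" by simp
qed (use assms in simp)

lemma stretch_zero: "stretch (0\<^sub>v r) k = 0\<^sub>v (r * k)"
  by (rule eq_vecI) (auto simp: less_mult_imp_div_less)

lemma dim_vprod:
  "dim_vec (vprod A x) = dim_row A * (lcm (dim_col A) (dim_vec x) div dim_col A)"
  by (simp add: vprod_def Let_def kron_def)

text \<open>
  Writing \<open>A \<otimes> I\<^sub>d\<close> out by entries leaves one nonzero term in each block of \<open>d\<close> columns; this is the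
  form in which the effect of stretching the argument becomes pure index arithmetic.
\<close>

lemma index_vprod:
  fixes A :: "real mat" and x :: "real vec"
  defines "t \<equiv> lcm (dim_col A) (dim_vec x)"
  defines "d \<equiv> t div dim_col A"
  assumes a: "a < dim_row A * d"
  shows "vprod A x $ a =
    (\<Sum>b<dim_col A. A $$ (a div d, b) * x $ ((b * d + a mod d) div (t div dim_vec x)))"
proof -
  define n where "n = dim_col A"
  define z where "z = stretch x (t div dim_vec x)"
  have nd: "n * d = t" by (simp add: n_def d_def t_def)
  have dz: "dim_vec z = n * d" unfolding nd by (simp add: z_def t_def)
  have d0: "d > 0" using a by (cases d) auto
  let ?g = "\<lambda>c. A $$ (a div d, c div d) * (if a mod d = c mod d then z $ c else 0)"
  have "vprod A x $ a = (kron A (1\<^sub>m d) *\<^sub>v z) $ a"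
    by (simp add: vprod_def Let_def z_def d_def t_def)
  also have "\<dots> = (\<Sum>c<n * d. ?g c)"
    using a d0 dz
    by (auto simp: kron_def scalar_prod_def n_def atLeast0LessThan intro!: sum.cong)
  also have "\<dots> = (\<Sum>b<n. sum ?g {b * d..<b * d + d})"
    by (rule sum.nat_group[symmetric])
  also have "\<dots> = (\<Sum>b<n. A $$ (a div d, b) * z $ (b * d + a mod d))"
  proof (rule sum.cong[OF refl])
    fix b
    have "sum ?g {b * d..<b * d + d} = sum ?g {b * d + a mod d}"
    proof (rule sum.mono_neutral_right)
      show "\<forall>c\<in>{b * d..<b * d + d} - {b * d + a mod d}. ?g c = 0"
      proof
        fix c assume c: "c \<in> {b * d..<b * d + d} - {b * d + a mod d}"
        then obtain e where e: "c = b * d + e" "e < d"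
          by (metis DiffD1 atLeastLessThan_iff le_Suc_ex nat_add_left_cancel_less)
        then have "c mod d = e" by simp
        with c e show "?g c = 0" by auto
      qed
    qed (use d0 in auto)
    then show "sum ?g {b * d..<b * d + d} = A $$ (a div d, b) * z $ (b * d + a mod d)"
      using d0 by simp
  qed
  also have "\<dots> = (\<Sum>b<n. A $$ (a div d, b) * x $ ((b * d + a mod d) div (t div dim_vec x)))"
  proof (rule sum.cong[OF refl])
    fix b assume "b \<in> {..<n}"
    then have "Suc b * d \<le> n * d" by (intro mult_le_mono1) auto
    moreover have "a mod d < d" using d0 by simp
    ultimately have "b * d + a mod d < n * d" unfolding mult_Suc by linarith
    then show "A $$ (a div d, b) * z $ (b * d + a mod d) =
        A $$ (a div d, b) * x $ ((b * d + a mod d) div (t div dim_vec x))"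
      using dz by (simp add: z_def)
  qed
  finally show ?thesis by (simp add: n_def)
qed

text \<open>
  The product does not see how finely the argument is subdivided. Passing from \<open>x\<close> to its stretch
  multiplies the common dimension \<open>t = lcm n r\<close> by some factor \<open>s\<close>, and \<open>A \<otimes> I\<^bsub>ds\<^esub> = (A \<otimes> I\<^sub>d) \<otimes> I\<^sub>s\<close>
  acts on \<open>s\<close>-fold repeated entries like \<open>A \<otimes> I\<^sub>d\<close>.
\<close>

lemma vprod_stretch:
  assumes n: "dim_col A > 0" and r: "dim_vec x > 0" and k: "k > 0"
  shows "\<exists>s>0. vprod A (stretch x k) = stretch (vprod A x) s"
proof -
  define n r where "n = dim_col A" and "r = dim_vec x"
  define t where "t = lcm n r"
  define t' where "t' = lcm n (r * k)"
  define s where "s = t' div t"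
  have "t dvd t'" by (simp add: t_def t'_def)
  then have t': "t' = t * s" by (simp add: s_def)
  have pos: "n > 0" "r > 0" "t > 0" "t' > 0"
    using assms by (auto simp: n_def r_def t_def t'_def lcm_pos_nat)
  then have s0: "s > 0" using t' by (cases s) auto
  define d where "d = t div n"
  define e where "e = t div r"
  have d': "t' div n = d * s" using t' by (simp add: d_def t_def div_mult_swap mult.commute)
  have e': "t' = r * k * (t' div (r * k))" by (simp add: t'_def)
  have e: "t = r * e" by (simp add: e_def t_def)
  have ke: "k * (t' div (r * k)) = e * s"
    using e e' t' pos(2) by (metis mult.assoc mult_cancel1 not_gr_zero)
  have "vprod A (stretch x k) = stretch (vprod A x) s"
  proof (rule eq_vecI)
    show dim: "dim_vec (vprod A (stretch x k)) = dim_vec (stretch (vprod A x) s)"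
      using d' by (simp add: dim_vprod n_def r_def t'_def t_def d_def mult.assoc)
    fix a assume "a < dim_vec (stretch (vprod A x) s)"
    then have a: "a < dim_row A * (d * s)"
      by (simp add: dim_vprod n_def r_def t_def d_def mult.assoc)
    then have as: "a div s < dim_row A * d"
      by (simp add: less_mult_imp_div_less mult.assoc)
    have "vprod A (stretch x k) $ a =
        (\<Sum>b<n. A $$ (a div (d * s), b) *
           stretch x k $ ((b * (d * s) + a mod (d * s)) div (t' div (r * k))))"
      using index_vprod[of a A "stretch x k"] a d'
      by (simp add: n_def r_def t'_def)
    also have "\<dots> = (\<Sum>b<n. A $$ (a div s div d, b) * x $ ((b * d + a div s mod d) div e))"
    proof (rule sum.cong[OF refl])
      fix b assume b: "b \<in> {..<n}"
      have ds0: "d * s > 0" using a by (cases "d * s") auto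
      let ?c = "b * (d * s) + a mod (d * s)"
      have "Suc b * (d * s) \<le> n * (d * s)" using b by (intro mult_le_mono1) auto
      then have "?c < n * (d * s)" using mod_less_divisor[OF ds0, of a] by simp
      also have "n * (d * s) = t'" by (simp flip: d' add: t'_def)
      finally have c: "?c div (t' div (r * k)) < r * k"
        using e' by (metis less_mult_imp_div_less)
      have "?c div (t' div (r * k)) div k = ?c div (e * s)"
        by (simp flip: ke div_mult2_eq add: mult.commute)
      also have "\<dots> = ?c div s div e"
        by (simp add: div_mult2_eq[symmetric] mult.commute)
      also have "?c div s = b * d + a div s mod d"
      proof -
        have "a mod (d * s) = s * (a div s mod d) + a mod s"
          by (simp add: mod_mult2_eq mult.commute[of d s])
        then have "?c = s * (b * d + a div s mod d) + a mod s"
          by (simp add: algebra_simps)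
        then show ?thesis using s0 by simp
      qed
      finally show "A $$ (a div (d * s), b) * stretch x k $ (?c div (t' div (r * k))) =
          A $$ (a div s div d, b) * x $ ((b * d + a div s mod d) div e)"
        using c by (simp add: r_def div_mult2_eq[symmetric] mult.commute)
    qed
    also have "\<dots> = vprod A x $ (a div s)"
      using index_vprod[of "a div s" A x] as
      by (simp add: n_def r_def t_def d_def e_def)
    also have "\<dots> = stretch (vprod A x) s $ a"
      using a by (simp add: dim_vprod n_def r_def t_def d_def mult.assoc)
    finally show "vprod A (stretch x k) $ a = stretch (vprod A x) s $ a" .
  qed
  with s0 show ?thesis by blast
qed

lemma vadd_dvd:
  assumes "dim_vec w dvd dim_vec y" "dim_vec y > 0"
  shows "vadd y w = y + stretch w (dim_vec y div dim_vec w)"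
proof -
  have "dim_vec y div dim_vec y = 1" using assms(2) by (intro div_self) linarith
  then have "stretch y (dim_vec y div dim_vec y) = y" by simp
  then show ?thesis using assms(1) by (simp only: vadd_def Let_def lcm_proj1_if_dvd_nat)
qed

lemma stretch_add:
  assumes "dim_vec x = dim_vec y"
  shows "stretch (x + y) k = stretch x k + stretch y k"
  using assms by (intro eq_vecI) (auto simp: less_mult_imp_div_less)

lemma vadd_stretch:
  assumes "dim_vec w dvd dim_vec y" "dim_vec y > 0" "k > 0"
  shows "vadd (stretch y k) w = stretch (vadd y w) k"
proof -
  have "dim_vec y * k div dim_vec w = dim_vec y div dim_vec w * k"
    using assms(1) by (simp add: div_mult_swap mult.commute)
  then show ?thesis
    using assms by (simp add: vadd_dvd stretch_add stretch_stretch)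
qed


section \<open>Vectors that agree after stretching\<close>

text \<open>
  Equality of the step functions on the unit interval that take the entries of the vectors as values
  on intervals of equal length. Stretching both sides makes the relation usable when neither
  dimension divides the other.
\<close>

definition stretch_equiv :: "real vec \<Rightarrow> real vec \<Rightarrow> bool" where
  "stretch_equiv x y \<longleftrightarrow> (\<exists>k>0. \<exists>l>0. stretch x k = stretch y l)"

lemma stretch_equiv_zero:
  assumes "r > 0" "r' > 0"
  shows "stretch_equiv (0\<^sub>v r) (0\<^sub>v r')"
proof -
  have "stretch (0\<^sub>v r) r' = stretch (0\<^sub>v r') r" by (simp add: stretch_zero mult.commute)
  with assms show ?thesis unfolding stretch_equiv_def by blast
qed

lemma stretch_equiv_same_dim:
  assumes "stretch_equiv x y" "dim_vec x = dim_vec y"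
  shows "x = y"
proof (cases "dim_vec x = 0")
  case True
  with assms(2) show ?thesis by (intro eq_vecI) auto
next
  case False
  obtain k l where kl: "k > 0" "l > 0" "stretch x k = stretch y l"
    using assms(1) by (auto simp: stretch_equiv_def)
  have "dim_vec x * k = dim_vec y * l" using arg_cong[OF kl(3), of dim_vec] by simp
  then have "k = l" using assms(2) False by simp
  then show ?thesis using kl assms(2) stretch_cancel by blast
qed

lemma stretch_equiv_vprod:
  assumes "dim_col A > 0" "dim_vec x > 0" "dim_vec y > 0" "stretch_equiv x y"
  shows "stretch_equiv (vprod A x) (vprod A y)"
  using assms vprod_stretch unfolding stretch_equiv_def by metis

lemma stretch_equiv_vadd:
  assumes "dim_vec w dvd dim_vec x" "dim_vec x > 0" "dim_vec w dvd dim_vec y" "dim_vec y > 0"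
    and "stretch_equiv x y"
  shows "stretch_equiv (vadd x w) (vadd y w)"
  using assms vadd_stretch unfolding stretch_equiv_def by metis

section \<open>Driven recursions\<close>

primrec state_at :: "('x \<Rightarrow> 'u \<Rightarrow> 'x) \<Rightarrow> 'x \<Rightarrow> (nat \<Rightarrow> 'u) \<Rightarrow> nat \<Rightarrow> 'x" where
  "state_at F x0 u 0 = x0"
| "state_at F x0 u (Suc t) = F (state_at F x0 u t) (u t)"

lemma state_at_cong:
  "(\<And>s. s < t \<Longrightarrow> u s = v s) \<Longrightarrow> state_at F x0 u t = state_at F x0 v t"
  by (induction t) auto

lemma state_at_concat:
  "state_at F x0 (\<lambda>t. if t < L then u t else v (t - L)) (L + T) =
     state_at F (state_at F x0 u L) v T"
proof (induction T)
  case 0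
  show ?case by (auto intro!: state_at_cong)
qed simp

text \<open>
  Both notions of controllability quantify over whole input, state and output sequences. The states
  are determined by the inputs, the outputs by the states, and inputs from time \<open>T\<close> on may be chosen
  at will, so only the choice of inputs remains.
\<close>

lemma ex_driven_iff_state_at:
  assumes "u0 \<in> U"
  shows "(\<exists>u x y. ((\<forall>t<T. u t \<in> U \<and> x (Suc t) = F (x t) (u t)) \<and> (\<forall>t\<le>T. y t = g (x t)))
             \<and> x 0 = x0 \<and> x T = xd)
     \<longleftrightarrow> (\<exists>u. (\<forall>t. u t \<in> U) \<and> state_at F x0 u T = xd)" (is "?l \<longleftrightarrow> ?r")
proof
  assume ?l
  then obtain u x where u: "\<And>t. t < T \<Longrightarrow> u t \<in> U"
    and x: "\<And>t. t < T \<Longrightarrow> x (Suc t) = F (x t) (u t)" and ends: "x 0 = x0" "x T = xd"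
    by blast
  define v where "v t = (if t < T then u t else u0)" for t
  have "t \<le> T \<Longrightarrow> x t = state_at F x0 v t" for t
    by (induction t) (use x ends in \<open>auto simp: v_def\<close>)
  then have "state_at F x0 v T = xd" using ends by simp
  moreover have "\<forall>t. v t \<in> U" using u assms by (simp add: v_def)
  ultimately show ?r by blast
next
  assume ?r
  then obtain u where "\<forall>t. u t \<in> U" "state_at F x0 u T = xd" by blast
  then show ?l
    by (intro exI[of _ u] exI[of _ "state_at F x0 u"] exI[of _ "\<lambda>t. g (state_at F x0 u t)"]) simp
qed

abbreviation v_step :: "real mat \<Rightarrow> real mat \<Rightarrow> real vec \<Rightarrow> real vec \<Rightarrow> real vec" where
  "v_step A B x w \<equiv> vadd (vprod A x) (B *\<^sub>v w)"

abbreviation lin_step :: "real mat \<Rightarrow> real mat \<Rightarrow> real vec \<Rightarrow> real vec \<Rightarrow> real vec" where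
  "lin_step A B x w \<equiv> A *\<^sub>v x + B *\<^sub>v w"

lemma v_controllable_from_to_iff:
  "v_controllable_from_to S x0 xd \<longleftrightarrow>
     (\<exists>T>0. \<exists>u. (\<forall>t. u t \<in> carrier_vec (dim_col (stB S))) \<and>
        state_at (v_step (stA S) (stB S)) x0 u T = xd)"
  unfolding v_controllable_from_to_def v_trajectory_def
  by (subst ex_driven_iff_state_at[OF zero_carrier_vec]) (rule refl)

lemma lin_controllable_from_to_iff:
  "lin_controllable_from_to S x0 xd \<longleftrightarrow>
     (\<exists>T>0. \<exists>u. (\<forall>t. u t \<in> carrier_vec (dim_col (stB S))) \<and>
        state_at (lin_step (stA S) (stB S)) x0 u T = xd)"
  unfolding lin_controllable_from_to_def lin_trajectory_def
  by (subst ex_driven_iff_state_at[OF zero_carrier_vec]) (rule refl)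

section \<open>Reachability for linear systems\<close>

context
  fixes M N :: "real mat" and n p :: nat
  assumes M: "M \<in> carrier_mat n n" and N: "N \<in> carrier_mat n p"
begin

lemma lin_state_carrier:
  assumes "x0 \<in> carrier_vec n" "\<And>t. u t \<in> carrier_vec p"
  shows "state_at (lin_step M N) x0 u t \<in> carrier_vec n"
  using assms M N by (induction t) auto

lemma lin_state_add:
  assumes x: "x \<in> carrier_vec n" "\<And>t. u t \<in> carrier_vec p"
    and y: "y \<in> carrier_vec n" "\<And>t. v t \<in> carrier_vec p"
  shows "state_at (lin_step M N) (x + y) (\<lambda>t. u t + v t) t =
    state_at (lin_step M N) x u t + state_at (lin_step M N) y v t"
proof (induction t)
  case (Suc t)
  let ?a = "state_at (lin_step M N) x u t" and ?b = "state_at (lin_step M N) y v t"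
  have c: "?a \<in> carrier_vec n" "?b \<in> carrier_vec n"
    using lin_state_carrier x y by blast+
  have "M *\<^sub>v (?a + ?b) + N *\<^sub>v (u t + v t) =
      (M *\<^sub>v ?a + M *\<^sub>v ?b) + (N *\<^sub>v u t + N *\<^sub>v v t)"
    using mult_add_distrib_mat_vec[OF M c] mult_add_distrib_mat_vec[OF N x(2) y(2)] by simp
  also have "\<dots> = (M *\<^sub>v ?a + N *\<^sub>v u t) + (M *\<^sub>v ?b + N *\<^sub>v v t)"
    using M N by (intro eq_vecI) auto
  finally show ?case using Suc by simp
qed simp

lemma lin_state_smult:
  assumes x: "x \<in> carrier_vec n" "\<And>t. u t \<in> carrier_vec p"
  shows "state_at (lin_step M N) (c \<cdot>\<^sub>v x) (\<lambda>t. c \<cdot>\<^sub>v u t) t =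
    c \<cdot>\<^sub>v state_at (lin_step M N) x u t"
proof (induction t)
  case (Suc t)
  let ?a = "state_at (lin_step M N) x u t"
  have a: "?a \<in> carrier_vec n" using lin_state_carrier x by blast
  have "M *\<^sub>v (c \<cdot>\<^sub>v ?a) + N *\<^sub>v (c \<cdot>\<^sub>v u t) = c \<cdot>\<^sub>v (M *\<^sub>v ?a) + c \<cdot>\<^sub>v (N *\<^sub>v u t)"
    using mult_mat_vec[OF M a] mult_mat_vec[OF N x(2)] by simp
  also have "\<dots> = c \<cdot>\<^sub>v (M *\<^sub>v ?a + N *\<^sub>v u t)"
    using M N by (intro smult_add_distrib_vec[symmetric, where n = n]) (use a x in auto)
  finally show ?case using Suc by simp
qed simp

definition reachable :: "nat \<Rightarrow> real vec set" where
  "reachable T = {state_at (lin_step M N) (0\<^sub>v n) u T | u. \<forall>t. u t \<in> carrier_vec p}"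

lemma reachableI:
  "(\<And>t. u t \<in> carrier_vec p) \<Longrightarrow> state_at (lin_step M N) (0\<^sub>v n) u T \<in> reachable T"
  unfolding reachable_def by blast

lemma reachable_add:
  assumes "x \<in> reachable T" "y \<in> reachable T"
  shows "x + y \<in> reachable T"
proof -
  obtain u v where u: "\<And>t. u t \<in> carrier_vec p" and v: "\<And>t. v t \<in> carrier_vec p"
    and xy: "x = state_at (lin_step M N) (0\<^sub>v n) u T" "y = state_at (lin_step M N) (0\<^sub>v n) v T"
    using assms unfolding reachable_def by blast
  have "x + y = state_at (lin_step M N) (0\<^sub>v n) (\<lambda>t. u t + v t) T"
    using lin_state_add[of "0\<^sub>v n" u "0\<^sub>v n" v T] u v xy by simp
  then show ?thesis using reachableI[of "\<lambda>t. u t + v t" T] u v by simp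
qed

lemma reachable_smult:
  assumes "x \<in> reachable T"
  shows "c \<cdot>\<^sub>v x \<in> reachable T"
proof -
  obtain u where u: "\<And>t. u t \<in> carrier_vec p"
    and x: "x = state_at (lin_step M N) (0\<^sub>v n) u T"
    using assms unfolding reachable_def by blast
  have "c \<cdot>\<^sub>v 0\<^sub>v n = 0\<^sub>v n" by (intro eq_vecI) auto
  then have "c \<cdot>\<^sub>v x = state_at (lin_step M N) (0\<^sub>v n) (\<lambda>t. c \<cdot>\<^sub>v u t) T"
    using lin_state_smult[of "0\<^sub>v n" u c T] u x by simp
  then show ?thesis using reachableI[of "\<lambda>t. c \<cdot>\<^sub>v u t" T] u by simp
qed

lemma lin_state_zero_input:
  "state_at (lin_step M N) (0\<^sub>v n) (\<lambda>_. 0\<^sub>v p) t = 0\<^sub>v n"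
  using M N by (induction t) auto

text \<open>
  Zero is an equilibrium under zero input, so an input sequence may be delayed.
\<close>

lemma reachable_mono:
  assumes "T \<le> T'"
  shows "reachable T \<subseteq> reachable T'"
proof
  fix x assume "x \<in> reachable T"
  then obtain u where u: "\<And>t. u t \<in> carrier_vec p"
    and x: "x = state_at (lin_step M N) (0\<^sub>v n) u T"
    unfolding reachable_def by blast
  define v where "v t = (if t < T' - T then 0\<^sub>v p else u (t - (T' - T)))" for t
  have "state_at (lin_step M N) (0\<^sub>v n) v T' = x"
    using state_at_concat[of "lin_step M N" "0\<^sub>v n" "T' - T" "\<lambda>_. 0\<^sub>v p" u T] assms
    by (simp add: v_def[abs_def] lin_state_zero_input x)
  then show "x \<in> reachable T'" using reachableI[of v T'] u by (simp add: v_def)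
qed

text \<open>
  The reachable sets are nested subspaces, so the latest of the times needed for the unit vectors
  works for all of their combinations. The induction is on the number of leading coordinates that
  may be nonzero.
\<close>

lemma reachable_uniform:
  assumes all: "\<And>xd. xd \<in> carrier_vec n \<Longrightarrow> \<exists>T. xd \<in> reachable T"
  shows "\<exists>T. carrier_vec n \<subseteq> reachable T"
proof -
  have "\<exists>T. \<forall>x \<in> carrier_vec n. (\<forall>b<n. k \<le> b \<longrightarrow> x $ b = 0) \<longrightarrow> x \<in> reachable T" for k
  proof (induction k)
    case 0
    have "x \<in> reachable 0" if "x \<in> carrier_vec n" "\<forall>b<n. x $ b = 0" for x
    proof -
      have "x = 0\<^sub>v n" using that by (intro eq_vecI) auto
      then show ?thesis using reachableI[of "\<lambda>_. 0\<^sub>v p" 0] by simp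
    qed
    then show ?case by auto
  next
    case (Suc k)
    obtain T1 where T1: "\<And>x. x \<in> carrier_vec n \<Longrightarrow> (\<And>b. b < n \<Longrightarrow> k \<le> b \<Longrightarrow> x $ b = 0)
        \<Longrightarrow> x \<in> reachable T1" using Suc by blast
    obtain T2 where T2: "unit_vec n k \<in> reachable T2"
      using all[OF unit_vec_carrier] by blast
    have "x \<in> reachable (max T1 T2)"
      if x: "x \<in> carrier_vec n" "\<forall>b<n. Suc k \<le> b \<longrightarrow> x $ b = 0" for x
    proof -
      define y where "y = vec n (\<lambda>b. if b = k then 0 else x $ b)"
      have "y \<in> reachable T1" by (rule T1) (use x in \<open>auto simp: y_def\<close>)
      then have "y \<in> reachable (max T1 T2)" using reachable_mono[of T1 "max T1 T2"] by auto
      moreover have "(x $ k) \<cdot>\<^sub>v unit_vec n k \<in> reachable (max T1 T2)"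
        using reachable_smult[OF T2] reachable_mono[of T2 "max T1 T2"] by auto
      moreover have "x = y + (x $ k) \<cdot>\<^sub>v unit_vec n k"
        using x by (intro eq_vecI) (auto simp: y_def unit_vec_def)
      ultimately show ?thesis using reachable_add by metis
    qed
    then show ?case by blast
  qed
  from this[of n] show ?thesis by (auto simp: subset_iff)
qed

text \<open>
  Superposition: to get from \<open>x0\<close> to \<open>xd\<close>, reach from zero the difference between \<open>xd\<close> and the state
  to which \<open>x0\<close> evolves freely. That state depends on the time, which therefore must be chosen first,
  independently of the difference to be reached.
\<close>

lemma lin_controllable_if_reachable:
  assumes all: "\<And>xd. xd \<in> carrier_vec n \<Longrightarrow> \<exists>T. xd \<in> reachable T"
    and x0: "x0 \<in> carrier_vec n" and xd: "xd \<in> carrier_vec n"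
  shows "\<exists>T>0. \<exists>u. (\<forall>t. u t \<in> carrier_vec p) \<and> state_at (lin_step M N) x0 u T = xd"
proof -
  obtain T0 where "carrier_vec n \<subseteq> reachable T0" using reachable_uniform[OF all] by blast
  then have T: "carrier_vec n \<subseteq> reachable (Suc T0)" using reachable_mono[of T0 "Suc T0"] by auto
  define z where "z = state_at (lin_step M N) x0 (\<lambda>_. 0\<^sub>v p) (Suc T0)"
  have z: "z \<in> carrier_vec n" unfolding z_def by (rule lin_state_carrier) (use x0 in auto)
  have "xd - z \<in> reachable (Suc T0)" using T z xd by auto
  then obtain u where u: "\<And>t. u t \<in> carrier_vec p"
    and d: "xd - z = state_at (lin_step M N) (0\<^sub>v n) u (Suc T0)"
    unfolding reachable_def by blast
  have "state_at (lin_step M N) x0 u (Suc T0) =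
      z + state_at (lin_step M N) (0\<^sub>v n) u (Suc T0)"
    using lin_state_add[of x0 "\<lambda>_. 0\<^sub>v p" "0\<^sub>v n" u "Suc T0"] x0 u
    by (simp add: z_def del: state_at.simps)
  also have "\<dots> = z + (xd - z)" by (simp only: d)
  also have "\<dots> = xd" using z xd by (intro eq_vecI) auto
  finally show ?thesis using u by blast
qed

end

section \<open>Dimensions along a trajectory\<close>

text \<open>
  One trajectory suffices: its eventual dimension \<open>r\<close> satisfies \<open>r = m (lcm n r) / n\<close>, and cancelling
  \<open>r\<close> from \<open>n r = m (lcm n r)\<close> exhibits \<open>n\<close> as a multiple of \<open>m\<close>.
\<close>

lemma dimension_bounded_imp_dvd:
  assumes "dimension_bounded A" "dim_col A > 0"
  shows "dim_row A dvd dim_col A"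
proof -
  have "0\<^sub>v 1 \<in> carrier_vec 1" by simp
  then obtain K rs where rs: "rs \<ge> 1"
    and K: "\<And>t. t \<ge> K \<Longrightarrow> (vprod A ^^ t) (0\<^sub>v 1) \<in> carrier_vec rs"
    using assms(1) unfolding dimension_bounded_def by (metis le_refl)
  define l where "l = lcm (dim_col A) rs"
  have "dim_vec (vprod A ((vprod A ^^ K) (0\<^sub>v 1))) = rs" using K[of "Suc K"] by simp
  then have "rs = dim_row A * (l div dim_col A)" using K[of K] by (simp add: dim_vprod l_def)
  then have "rs * dim_col A = dim_row A * (l div dim_col A * dim_col A)" by simp
  also have "l div dim_col A * dim_col A = l" by (simp add: l_def)
  also have "l = rs * (l div rs)" by (simp add: l_def)
  finally have "rs * dim_col A = rs * (dim_row A * (l div rs))" by (simp only: ac_simps)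
  then have "dim_col A = dim_row A * (l div rs)" using rs by simp
  then show ?thesis by (rule dvdI)
qed

text \<open>
  The two-stage recursion through \<^const>\<open>dim_xi\<close> amounts to iterating one map, the one by which
  the product with an \<open>m \<times> m\<mu>\<close> matrix changes dimensions; hence the
  value at which it terminates is a fixed point of that map.
\<close>

lemma dim_seq_Suc:
  assumes "m > 0" "\<mu> > 0"
  shows "dim_seq m \<mu> r (Suc l) =
    m * (lcm (m * \<mu>) (dim_seq m \<mu> r l) div (m * \<mu>))"
proof (cases l)
  case 0
  then show ?thesis by (simp add: lcm.commute)
next
  case (Suc k)
  have "lcm (m * \<mu>) (dim_xi m \<mu> r k * m) = m * lcm (dim_xi m \<mu> r k) \<mu>"
    using lcm_mult_left[of m "dim_xi m \<mu> r k" \<mu>] by (simp add: lcm.commute mult.commute)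
  then show ?thesis using Suc assms by simp
qed

text \<open>
  The dimension of a product is a multiple of \<open>m\<close>, so adding \<open>B w\<close> does not raise it further.
\<close>

lemma dim_v_step:
  assumes "A \<in> carrier_mat m n" "B \<in> carrier_mat m p" "m > 0" "n > 0" "dim_vec x > 0"
  shows "dim_vec (vprod A x) > 0" "dim_vec (B *\<^sub>v w) dvd dim_vec (vprod A x)"
    and "dim_vec (v_step A B x w) = m * (lcm n (dim_vec x) div n)"
    and "dim_vec (v_step A B x w) > 0"
proof -
  have "lcm n (dim_vec x) > 0" using assms by (simp add: lcm_pos_nat)
  then have "lcm n (dim_vec x) div n > 0"
    using assms(4) by (simp add: div_greater_zero_iff dvd_imp_le)
  then show 1: "dim_vec (vprod A x) > 0" using assms by (simp add: dim_vprod)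
  show 2: "dim_vec (B *\<^sub>v w) dvd dim_vec (vprod A x)" using assms by (simp add: dim_vprod)
  show 3: "dim_vec (v_step A B x w) = m * (lcm n (dim_vec x) div n)"
    using vadd_dvd[OF 2 1] assms 2 by (simp add: dim_vprod)
  show "dim_vec (v_step A B x w) > 0" using 1 3 assms by (simp add: dim_vprod)
qed

lemma stretch_equiv_v_state:
  assumes "A \<in> carrier_mat m n" "B \<in> carrier_mat m p" "m > 0" "n > 0"
    and "dim_vec x > 0" "dim_vec y > 0" "stretch_equiv x y"
  shows "stretch_equiv (state_at (v_step A B) x u t) (state_at (v_step A B) y u t)
    \<and> dim_vec (state_at (v_step A B) x u t) > 0 \<and> dim_vec (state_at (v_step A B) y u t) > 0"
proof (induction t)
  case 0
  with assms show ?case by simp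
next
  case (Suc t)
  note step = dim_v_step[OF assms(1-4)]
  from Suc have x: "dim_vec (state_at (v_step A B) x u t) > 0"
    and y: "dim_vec (state_at (v_step A B) y u t) > 0"
    and e: "stretch_equiv (state_at (v_step A B) x u t) (state_at (v_step A B) y u t)" by auto
  have "dim_col A > 0" using assms by simp
  from stretch_equiv_vadd[OF step(2)[OF x] step(1)[OF x] step(2)[OF y] step(1)[OF y]
      stretch_equiv_vprod[OF this x y e]] step(4)[OF x] step(4)[OF y]
  show ?case by simp
qed

section \<open>The stationary realization\<close>

lemma kron_col_ones_mult:
  assumes "w \<in> carrier_vec (dim_col B)"
  shows "kron B (col_mat (ones k)) *\<^sub>v w = stretch (B *\<^sub>v w) k"
proof (rule eq_vecI)
  fix a assume "a < dim_vec (stretch (B *\<^sub>v w) k)"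
  then have a: "a < dim_row B * k" by simp
  then have "k > 0" by (cases k) auto
  have "stretch (B *\<^sub>v w) k $ a = (B *\<^sub>v w) $ (a div k)" using a by simp
  then show "(kron B (col_mat (ones k)) *\<^sub>v w) $ a = stretch (B *\<^sub>v w) k $ a"
    using a assms \<open>k > 0\<close>
    by (auto simp: kron_def ones_def mat_of_cols_def scalar_prod_def less_mult_imp_div_less
        intro!: sum.cong)
qed (simp, simp add: kron_def ones_def)

text \<open>
  The hypothesis on \<open>j\<close> says that the product with \<open>A\<close> maps vectors of dimension \<open>j\<close> to vectors of
  dimension \<open>j\<close>. It makes the definite description of the stationary matrix proper, and it makes
  \<open>j\<close> a multiple of \<open>m\<close>, so that adding \<open>B w\<close> means adding \<open>B w \<otimes> 1\<close>.
\<close>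

lemma v_state_eq_lin_state:
  assumes A: "A \<in> carrier_mat m n" and B: "B \<in> carrier_mat m p" and pos: "m > 0" "n > 0" "j > 0"
    and fix_dim: "m * (lcm n j div n) = j"
  defines "As \<equiv> stationary_matrix A j" and "Bs \<equiv> kron B (col_mat (ones (j div m)))"
  shows "As \<in> carrier_mat j j" and "Bs \<in> carrier_mat j p"
    and "\<And>x u t. x \<in> carrier_vec j \<Longrightarrow> (\<And>t. u t \<in> carrier_vec p) \<Longrightarrow>
      state_at (v_step A B) x u t = state_at (lin_step As Bs) x u t"
proof -
  have inv: "vprod A x \<in> carrier_vec j" if "x \<in> carrier_vec j" for x
    using that A fix_dim by (intro carrier_vecI) (simp add: dim_vprod)
  have "\<exists>!P. P \<in> carrier_mat j j \<and> (\<forall>x\<in>carrier_vec j. P *\<^sub>v x = vprod A x)"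
    by (rule stationary_matrix_ex1) (use pos A inv in auto)
  from theI'[OF this] have As: "As \<in> carrier_mat j j"
    and As_mult: "\<And>x. x \<in> carrier_vec j \<Longrightarrow> As *\<^sub>v x = vprod A x"
    unfolding As_def stationary_matrix_def by auto
  then show "As \<in> carrier_mat j j" by simp
  have mj: "m dvd j" using fix_dim by (metis dvd_triv_left)
  then show Bs: "Bs \<in> carrier_mat j p" using B by (auto simp: Bs_def kron_def ones_def)
  fix x :: "real vec" and u :: "nat \<Rightarrow> real vec" and t :: nat
  assume x: "x \<in> carrier_vec j" and u: "\<And>t. u t \<in> carrier_vec p"
  have step: "v_step A B y w = lin_step As Bs y w"
    if "y \<in> carrier_vec j" "w \<in> carrier_vec p" for y w
    using vadd_dvd[of "B *\<^sub>v w" "vprod A y"] carrier_vecD[OF inv[OF that(1)]] pos mj that B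
    by (simp add: Bs_def kron_col_ones_mult As_mult)
  show "state_at (v_step A B) x u t = state_at (lin_step As Bs) x u t"
    by (induction t) (simp_all add: step u lin_state_carrier[OF As Bs x, of u])
qed

theorem mainTheorem3:
  fixes A B C :: "real mat" and S :: control_system and m n p q i j :: nat
  assumes "A \<in> carrier_mat m n" and "B \<in> carrier_mat m p" and "C \<in> carrier_mat q m"
    and "m \<ge> 1" and "n \<ge> 1" and "p \<ge> 1" and "q \<ge> 1" and "i \<ge> 1" and "j \<ge> 1"
    and "S = \<lparr>stA = A, stB = B, stC = C\<rparr>"
  shows "(dimension_bounded A \<and> dim_seq_terminates_at A i j \<and>
            lin_controllable (stationary_realization S j)
          \<longrightarrow> v_controllable S i j) \<and>
         (dimension_bounded A \<and> dim_seq_terminates_at A i j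
          \<longrightarrow> v_controllable S i j
          \<longrightarrow> lin_controllable (stationary_realization S j))"
proof -
  have *: "lin_controllable (stationary_realization S j) \<longleftrightarrow> v_controllable S i j"
    if bounded: "dimension_bounded A" and terminates: "dim_seq_terminates_at A i j"
  proof -
    have pos: "m > 0" "n > 0" "i > 0" "j > 0" using assms by auto
    define \<mu> where "\<mu> = n div m"
    have "m dvd n" using dimension_bounded_imp_dvd[OF bounded] assms(1) pos by simp
    then have n: "n = m * \<mu>" by (simp add: \<mu>_def)
    have \<mu>: "\<mu> > 0" using pos n by (cases \<mu>) auto
    have seq_Suc: "dim_seq m \<mu> i (Suc l) = m * (lcm n (dim_seq m \<mu> i l) div n)" for l
      unfolding n by (rule dim_seq_Suc[OF pos(1) \<mu>])
    obtain L where L: "\<And>l. l \<ge> L \<Longrightarrow> dim_seq m \<mu> i l = j"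
      using terminates assms(1) by (auto simp: dim_seq_terminates_at_def \<mu>_def)
    have fix_dim: "m * (lcm n j div n) = j"
      using seq_Suc[of L] L[of L] L[of "Suc L"] by (simp del: dim_seq.simps)
    define As where "As = stationary_matrix A j"
    define Bs where "Bs = kron B (col_mat (ones (j div m)))"
    note st = v_state_eq_lin_state[OF assms(1,2) pos(1,2,4) fix_dim, folded As_def Bs_def]
    note As = st(1) and Bs = st(2)
    have lin: "lin_controllable (stationary_realization S j) \<longleftrightarrow>
        (\<forall>x0\<in>carrier_vec j. \<forall>xd\<in>carrier_vec j. \<exists>T>0. \<exists>u. (\<forall>t. u t \<in> carrier_vec p) \<and>
           state_at (lin_step As Bs) x0 u T = xd)"
      using assms As Bs
      by (simp add: lin_controllable_def lin_controllable_from_to_iff stationary_realization_def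
          flip: As_def Bs_def)
    have v: "v_controllable S i j \<longleftrightarrow>
        (\<forall>x0\<in>carrier_vec i. \<forall>xd\<in>carrier_vec j. \<exists>T>0. \<exists>u. (\<forall>t. u t \<in> carrier_vec p) \<and>
           state_at (v_step A B) x0 u T = xd)"
      using assms by (simp add: v_controllable_def v_controllable_from_to_iff)
    have dim: "dim_vec (state_at (v_step A B) x0 u t) = dim_seq m \<mu> i t
        \<and> dim_seq m \<mu> i t > 0" if "x0 \<in> carrier_vec i" for x0 u t
    proof (induction t)
      case 0
      then show ?case using that pos by simp
    next
      case (Suc t)
      then have "dim_vec (state_at (v_step A B) x0 u t) > 0" by simp
      from dim_v_step(3,4)[OF assms(1,2) pos(1,2) this, of "u t"] Suc
      show ?case unfolding seq_Suc by simp
    qed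
    show ?thesis unfolding lin v
    proof (intro iffI ballI)
      fix x0 xd :: "real vec"
      assume ctrl: "\<forall>x0\<in>carrier_vec j. \<forall>xd\<in>carrier_vec j. \<exists>T>0. \<exists>u.
          (\<forall>t. u t \<in> carrier_vec p) \<and> state_at (lin_step As Bs) x0 u T = xd"
        and x0: "x0 \<in> carrier_vec i" and xd: "xd \<in> carrier_vec j"
      \<comment> \<open>Wait with zero input until the dimension has become stationary.\<close>
      define z where "z = state_at (v_step A B) x0 (\<lambda>_. 0\<^sub>v p) L"
      have z: "z \<in> carrier_vec j"
        using dim[OF x0, of _ L] L[of L] by (intro carrier_vecI) (simp add: z_def)
      obtain T u where T: "T > 0" and u: "\<And>t. u t \<in> carrier_vec p"
        and "state_at (lin_step As Bs) z u T = xd" using ctrl z xd by metis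
      then have "state_at (v_step A B) z u T = xd" using st(3)[OF z u] by simp
      then have "state_at (v_step A B) x0 (\<lambda>t. if t < L then 0\<^sub>v p else u (t - L)) (L + T) = xd"
        using state_at_concat[of "v_step A B" x0 L "\<lambda>_. 0\<^sub>v p" u T] by (simp add: z_def)
      moreover have "\<forall>t. (if t < L then 0\<^sub>v p else u (t - L)) \<in> carrier_vec p" using u by simp
      moreover have "L + T > 0" using T by simp
      ultimately show "\<exists>T>0. \<exists>u. (\<forall>t. u t \<in> carrier_vec p) \<and> state_at (v_step A B) x0 u T = xd"
        by (intro exI[of _ "L + T"] exI[of _ "\<lambda>t. if t < L then 0\<^sub>v p else u (t - L)"] conjI)
    next
      fix x0 xd :: "real vec"
      assume ctrl: "\<forall>x0\<in>carrier_vec i. \<forall>xd\<in>carrier_vec j. \<exists>T>0. \<exists>u.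
          (\<forall>t. u t \<in> carrier_vec p) \<and> state_at (v_step A B) x0 u T = xd"
        and x0: "x0 \<in> carrier_vec j" and xd: "xd \<in> carrier_vec j"
      have "\<exists>T. y \<in> reachable As Bs j p T" if y: "y \<in> carrier_vec j" for y
      proof -
        obtain T u where u: "\<And>t. u t \<in> carrier_vec p"
          and T: "state_at (v_step A B) (0\<^sub>v i) u T = y"
          using ctrl y by (metis zero_carrier_vec)
        \<comment> \<open>Run the same input from the zero vector of the stationary dimension.\<close>
        let ?y' = "state_at (v_step A B) (0\<^sub>v j) u T"
        have eq: "?y' = state_at (lin_step As Bs) (0\<^sub>v j) u T"
          by (rule st(3)) (use u in auto)
        have "stretch_equiv y ?y'"
          using stretch_equiv_v_state[OF assms(1,2) pos(1,2) _ _
              stretch_equiv_zero[OF pos(3,4)], of u T] pos T by simp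
        moreover have "dim_vec ?y' = j"
          unfolding eq by (rule carrier_vecD[OF lin_state_carrier[OF As Bs]]) (use u in auto)
        ultimately have "y = ?y'" using y by (intro stretch_equiv_same_dim) auto
        then show ?thesis using reachableI[OF As Bs, of u T] u eq by auto
      qed
      then show "\<exists>T>0. \<exists>u. (\<forall>t. u t \<in> carrier_vec p) \<and> state_at (lin_step As Bs) x0 u T = xd"
        by (intro lin_controllable_if_reachable[OF As Bs _ x0 xd])
    qed
  qed
  then show ?thesis by blast
qed

end
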